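(* Let $j\ge 0$, $n\ge 1$, $p,q\ge 0$ be integers, let $a_1,\dots,a_p$ and $b_1,\dots,b_q$ be non-zero complex numbers with no $b_i$ a non-positive integer, and put $b_{q+1}=1$. The action of $U_n$ on functions of the form $x^j\,{}_pF_q(\mathbf{a},\mathbf{b};x)=x^j\sum_{k=0}^\infty \frac{(a_1)_k\cdots(a_p)_k}{(b_1)_k\cdots(b_{q+1})_k}x^k$ is characterized as follows. Put $x_1 = n^{n(p-q-1)}x$. (1) If $n$ divides $j$, then $$U_n\left(x^j\sum_{k=0}^\infty \frac{(a_1)_k\cdots(a_p)_k}{(b_1)_k\cdots(b_{q+1})_k}x^k\right) = x^{j/n}\sum_{k=0}^\infty \frac{(c_1)_k (c_2)_k\cdots(c_{np})_k}{(d_1)_k (d_2)_k\cdots(d_{n(q+1)-1})_k}\,\frac{x_1^k}{k!},$$ where $c_{in+l} = \frac{a_{i+1}+l-1}{n}$ for $0\le i\le p-1$, $1\le l\le n$, and $d_{in+l} = \frac{b_{i+1}+l-1}{n}$ for $0\le i\le q$, $1\le l\le n$. (2) If $n$ does not divide $j$, then $$U_n\left(x^j\sum_{k=0}^\infty \frac{(a_1)_k\cdots(a_p)_k}{(b_1)_k\cdots(b_{q+1})_k}x^k\right) = x^{1+\lfloor j/n\rfloor}\sum_{k=0}^\infty \frac{(c_1)_k\cdots(c_{pn})_k}{(d_1)_k\cdots(d_{(q+1)n-1})_k}\,\frac{x_1^k}{k!},$$ where now $r = n(1-\{j/n\})-1$, $c_{in+l} = \frac{a_{i+1}+r+l}{n}$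 for $0\le i\le p-1$, $1\le l\le n$, and $d_{in+l} = \frac{b_{i+1}+r+l}{n}$ for $0\le i\le q$, $1\le l\le n$.
   Context: All series are formal power series over $\mathbb{C}$. For $n\ge 1$, the operator $U_n$ acts on formal power series by $U_n\left(\sum_{k\ge0} c_k x^k\right) = \sum_{k\ge 0} c_{nk}x^k$. The ascending factorial is $(c)_0=1$, $(c)_k = c(c+1)\cdots(c+k-1)$; in particular $(1)_k=k!$. $\lfloor t\rfloor$ and $\{t\}=t-\lfloor t\rfloor$ are the integer and fractional parts. The hypergeometric series is ${}_pF_q(\mathbf{a},\mathbf{b};x)=\sum_{k\ge 0}\frac{(a_1)_k\cdots(a_p)_k}{(b_1)_k\cdots(b_q)_k}\frac{x^k}{k!}$ with $\mathbf{a}=(a_1,\dots,a_p)$, $\mathbf{b}=(b_1,\dots,b_q)$; setting $b_{q+1}=1$ absorbs the factor $k!$ into the denominator.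
   Formalization: Part (2) is false as printed; the formal version multiplies its right side by the product of the (a_i)_{r+1} over that of the (b_i)_{r+1} (i up to q+1), and omits the lower parameter d_{qn+n-1-r}, which equals 1, instead of d_{(q+1)n}. *)

theory Defs
  imports Complex_Main
    "HOL-Computational_Algebra.Formal_Power_Series"
    "HOL-Library.Nonpos_Ints"
begin

definition U_op :: "nat \<Rightarrow> complex fps \<Rightarrow> complex fps" where
  "U_op n f = Abs_fps (\<lambda>k. fps_nth f (n * k))"

(* The hypergeometric series is the library's fps_hypergeo; its last argument w rescales the
   variable, so that fps_hypergeo as bs w is the series of as, bs evaluated at w * x. The lower
   parameters it takes do not include the one equal to 1 that accounts for k!.

   In the case where n does not divide j, the theorem corrects the formula of the source, which has
   no constant factor and always omits the last lower parameter d_{(q+1)n}; that formula is false: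
   - Factoring (a)_{nk+r+1} = (a)_{r+1} (a+r+1)_{nk} leaves the constant
     (a_1)_{r+1} ... (a_p)_{r+1} / ((b_1)_{r+1} ... (b_{q+1})_{r+1}).
     Without it the formula already fails at the leading coefficient for
     n = 2, j = 1, p = 1, q = 0, a_1 = 2 (the coefficient of x is 2, not 1).
   - The k! is absorbed by the parameter d_{qn+l} = (1+r+l)/n that equals 1. That is the one with
     l = n-1-r, not the last one (l = n) as in the case where n divides j. Omitting the last
     one instead fails for n = 2, j = 1, p = q = 0 (the coefficient of x^2 is 1/6, not 1/4). *)

end

theory Submission
  imports Defs
begin

text \<open>
  The operator \<open>U_op n\<close> keeps the coefficients of \<open>fps_X ^ j * F\<close> at the multiples of
  \<open>n\<close>. Let \<open>n * e\<close> be the least multiple of \<open>n\<close> that is at least \<open>j\<close>, and write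
  \<open>n * e = j + s\<close> with \<open>s < n\<close>. The coefficients kept are then those of \<open>F\<close> at
  \<open>s + n * k\<close>, and they land at \<open>e + k\<close>. Both cases of the theorem are this one computation:
  \<open>s = 0\<close> and \<open>e = j div n\<close> if \<open>n\<close> divides \<open>j\<close>, and \<open>s = r + 1\<close> and
  \<open>e = 1 + j div n\<close> otherwise.

  For a hypergeometric \<open>F\<close> each parameter \<open>z\<close> contributes \<open>pochhammer z (s + n * k)\<close>.
  This is \<open>pochhammer z s\<close>, a constant in \<open>k\<close>, times \<open>pochhammer (z + s) (n * k)\<close>, and
  Gauss' multiplication formula (lemma \<open>pochhammer_multiple\<close>) splits the latter into \<open>n\<close>
  ascending factorials of length \<open>k\<close> and the power \<open>n ^ (n * k)\<close>. The powers of all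
  parameters together give the rescaling of the variable. Counting \<open>k!\<close> as the ascending
  factorial of the lower parameter 1 makes numerator and denominator alike; among the \<open>n\<close> parameters
  \<open>(s + l) / n\<close> that come from this 1, the one with \<open>l = n - s\<close> is 1 again and is the new
  \<open>k!\<close>. Lemma \<open>U_op_fps_hypergeo\<close> carries this out for every \<open>s < n\<close>.
\<close>

section \<open>Ascending factorials along an arithmetic progression\<close>

text \<open>
  The \<open>n * k\<close> factors \<open>z + i\<close> are distributed over the residue classes of \<open>i\<close> modulo
  \<open>n\<close>; within a class they are \<open>n\<close> times the factors of an ascending factorial.
\<close>
lemma pochhammer_multiple:
  fixes z :: "'a :: field_char_0"
  assumes "n > 0"
  shows "pochhammer z (n * k) =
    of_nat n ^ (n * k) * (\<Prod>l=1..n. pochhammer ((z + of_nat l - 1) / of_nat n) k)"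
proof (induction k)
  case 0
  then show ?case by simp
next
  case (Suc k)
  have "pochhammer (z + of_nat (n * k)) n = (\<Prod>i<n. z + of_nat (n * k) + of_nat i)"
    by (simp add: pochhammer_prod atLeast0LessThan)
  also have "\<dots> = (\<Prod>l=1..n. z + of_nat (n * k) + of_nat l - 1)"
    by (rule prod.reindex_bij_witness[of _ "\<lambda>l. l - 1" Suc]) auto
  also have "\<dots> = (\<Prod>l=1..n. of_nat n * ((z + of_nat l - 1) / of_nat n + of_nat k))"
    using assms by (intro prod.cong) (auto simp: field_simps)
  finally have step: "pochhammer (z + of_nat (n * k)) n =
      of_nat n ^ n * (\<Prod>l=1..n. (z + of_nat l - 1) / of_nat n + of_nat k)"
    by (simp add: prod.distrib)
  have "pochhammer z (n * Suc k) = pochhammer z (n * k) * pochhammer (z + of_nat (n * k)) n"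
    using pochhammer_product'[of z "n * k" n] by (simp add: add.commute)
  then show ?case
    unfolding Suc.IH step by (simp add: pochhammer_Suc prod.distrib power_add mult_ac)
qed

lemma prod_blocks:
  fixes f :: "nat \<Rightarrow> 'a :: comm_monoid_mult"
  shows "(\<Prod>m=1..n * p. f m) = (\<Prod>i<p. \<Prod>l=1..n. f (i * n + l))"
proof (induction p)
  case 0
  then show ?case by simp
next
  case (Suc p)
  have "(\<Prod>m=1..n * Suc p. f m) = (\<Prod>m=1..n * p. f m) * (\<Prod>m=n * p + 1..n * p + n. f m)"
    by (subst prod.ub_add_nat[symmetric]) (simp_all add: add.commute)
  also have "(\<Prod>m=n * p + 1..n * p + n. f m) = (\<Prod>l=1..n. f (p * n + l))"
    by (rule prod.reindex_bij_witness[of _ "\<lambda>l. p * n + l" "\<lambda>m. m - p * n"])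
      (auto simp: mult.commute)
  finally show ?case using Suc.IH by simp
qed

text \<open>
  This is the passage from the parameters \<open>a\<close> to the parameters \<open>c\<close>; it serves the upper and
  the lower parameters alike.
\<close>
lemma prod_pochhammer_progression:
  fixes a c :: "nat \<Rightarrow> 'a :: field_char_0"
  assumes "n > 0"
    and c: "\<And>i l. i < p \<Longrightarrow> l \<in> {1..n} \<Longrightarrow>
      c (i * n + l) = (a (i + 1) + of_nat s + of_nat l - 1) / of_nat n"
  shows "(\<Prod>i=1..p. pochhammer (a i) (s + n * k)) =
    (\<Prod>i=1..p. pochhammer (a i) s) * (of_nat n ^ (n * k)) ^ p * (\<Prod>m=1..n * p. pochhammer (c m) k)"
proof -
  have split: "pochhammer (a (i + 1)) (s + n * k) = pochhammer (a (i + 1)) s *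
      (of_nat n ^ (n * k) * (\<Prod>l=1..n. pochhammer (c (i * n + l)) k))" if "i < p" for i
    using c[OF that] by (simp add: pochhammer_product' pochhammer_multiple[OF assms(1)])
  have shift: "(\<Prod>i=1..p. g i) = (\<Prod>i<p. g (i + 1))" for g :: "nat \<Rightarrow> 'a"
    by (rule prod.reindex_bij_witness[of _ Suc "\<lambda>i. i - 1"]) auto
  have "(\<Prod>i<p. pochhammer (a (i + 1)) (s + n * k)) = (\<Prod>i<p. pochhammer (a (i + 1)) s *
      (of_nat n ^ (n * k) * (\<Prod>l=1..n. pochhammer (c (i * n + l)) k)))"
    by (intro prod.cong refl split) auto
  then show ?thesis
    unfolding shift prod_blocks by (simp add: prod.distrib mult_ac)
qed

section \<open>Sections of hypergeometric series\<close>

unbundle fps_syntax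

lemma fps_hypergeo_nth_prod_list:
  "fps_hypergeo as bs w $ k =
    prod_list (map (\<lambda>z. pochhammer z k) as) * w ^ k /
    (prod_list (map (\<lambda>z. pochhammer z k) bs) * fact k)"
proof -
  have "foldl (\<lambda>r z. r * f z) v zs = v * prod_list (map f zs)"
    for f :: "'a \<Rightarrow> 'a" and v zs
    by (induction zs arbitrary: v) (auto simp: mult_ac)
  then show ?thesis by simp
qed

text \<open>
  The series is indexed here by the full list of lower parameters, including the one equal to 1 that
  stands for \<open>k!\<close>. Its position \<open>i0\<close> is arbitrary because the argument 1 that \<open>U_op\<close>
  produces is in general not the last one.
\<close>
lemma fps_hypergeo_nth_omit_one:
  fixes c d :: "nat \<Rightarrow> 'a :: field_char_0"
  assumes "i0 \<in> {1..N}" and "d i0 = 1"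
  shows "fps_hypergeo (map c [1..<M + 1]) (map d (filter (\<lambda>m. m \<noteq> i0) [1..<N + 1])) w $ k =
    (\<Prod>m=1..M. pochhammer (c m) k) * w ^ k / (\<Prod>m=1..N. pochhammer (d m) k)"
proof -
  let ?L = "filter (\<lambda>m. m \<noteq> i0) [1..<N + 1]"
  have upper: "prod_list (map (\<lambda>z. pochhammer z k) (map c [1..<M + 1])) =
      (\<Prod>m=1..M. pochhammer (c m) k)"
    by (simp add: prod.distinct_set_conv_list[symmetric] o_def atLeastLessThanSuc_atLeastAtMost
        del: upt_Suc)
  have "set ?L = {1..N} - {i0}" by auto
  then have "prod_list (map (\<lambda>z. pochhammer z k) (map d ?L)) =
      (\<Prod>m\<in>{1..N} - {i0}. pochhammer (d m) k)"
    using prod.distinct_set_conv_list[of ?L "\<lambda>m. pochhammer (d m) k"]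
    by (simp add: o_def del: upt_Suc)
  moreover have "(\<Prod>m=1..N. pochhammer (d m) k) =
      pochhammer (d i0) k * (\<Prod>m\<in>{1..N} - {i0}. pochhammer (d m) k)"
    using assms(1) by (intro prod.remove) auto
  ultimately have lower: "prod_list (map (\<lambda>z. pochhammer z k) (map d ?L)) * fact k =
      (\<Prod>m=1..N. pochhammer (d m) k)"
    using assms(2) by (simp only: pochhammer_fact[symmetric] mult.commute)
  show ?thesis unfolding fps_hypergeo_nth_prod_list upper lower ..
qed

text \<open>
  Because \<open>s < n\<close>, the number \<open>n * e\<close> is the first multiple of \<open>n\<close> not below
  \<open>j\<close>, so exactly \<open>e\<close> of the coefficients kept fall below the factor \<open>fps_X ^ j\<close> and
  vanish.
\<close>
lemma U_op_fps_X_power_mult: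
  assumes "s < n" and "j + s = n * e"
    and F: "\<And>k. F $ (s + n * k) = C * G $ k"
  shows "U_op n (fps_X ^ j * F) = fps_const C * fps_X ^ e * G"
proof (rule fps_ext)
  fix m
  show "U_op n (fps_X ^ j * F) $ m = (fps_const C * fps_X ^ e * G) $ m"
  proof (cases "m < e")
    case True
    then have "n * (m + 1) \<le> n * e" by (intro mult_le_mono2) auto
    then have "n * m < j" using assms(1,2) by simp
    then show ?thesis using True by (simp add: U_op_def fps_X_power_mult_nth mult.assoc)
  next
    case False
    then obtain k where m: "m = e + k" using le_Suc_ex not_less by blast
    then have nm: "n * m = j + (s + n * k)" using assms(2) by (simp add: algebra_simps)
    have "U_op n (fps_X ^ j * F) $ m = F $ (s + n * k)"
      by (simp add: U_op_def fps_X_power_mult_nth nm)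
    then show ?thesis using F m by (simp add: fps_X_power_mult_nth mult.assoc)
  qed
qed

text \<open>
  The two cases of the theorem differ only in \<open>s\<close>. The parameters \<open>d (q * n + l)\<close> come from
  \<open>b (q + 1) = 1\<close> and equal \<open>(s + l) / n\<close>, which is 1 exactly for \<open>l = n - s\<close>; that is
  why this index is left out.
\<close>
lemma U_op_fps_hypergeo:
  fixes a b c d :: "nat \<Rightarrow> complex"
  assumes s: "s < n" and je: "j + s = n * e" and b_last: "b (q + 1) = 1"
    and c: "\<And>i l. i < p \<Longrightarrow> l \<in> {1..n} \<Longrightarrow>
      c (i * n + l) = (a (i + 1) + of_nat s + of_nat l - 1) / of_nat n"
    and d: "\<And>i l. i < q + 1 \<Longrightarrow> l \<in> {1..n} \<Longrightarrow>
      d (i * n + l) = (b (i + 1) + of_nat s + of_nat l - 1) / of_nat n"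
  shows "U_op n (fps_X ^ j * fps_hypergeo (map a [1..<p + 1]) (map b [1..<q + 1]) 1) =
    fps_const ((\<Prod>i=1..p. pochhammer (a i) s) / (\<Prod>i=1..q + 1. pochhammer (b i) s)) *
    fps_X ^ e *
    fps_hypergeo (map c [1..<n * p + 1])
      (map d (filter (\<lambda>m. m \<noteq> q * n + (n - s)) [1..<n * (q + 1) + 1]))
      (of_nat n powi (int n * (int p - int q - 1)))"
proof (rule U_op_fps_X_power_mult[OF s je])
  fix k
  let ?w = "of_nat n powi (int n * (int p - int q - 1)) :: complex"
  from s have n: "n > 0" by simp
  have d_one: "d (q * n + (n - s)) = 1"
    using s b_last by (subst d) (auto simp: of_nat_diff)
  have i0: "q * n + (n - s) \<in> {1..n * (q + 1)}"
    using s by (auto simp: algebra_simps)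
  \<comment> \<open>The original series is itself of the form with one lower parameter equal to 1 left out:
    here it is the last one, \<open>b (q + 1)\<close>.\<close>
  have "filter (\<lambda>m. m \<noteq> q + 1) [1..<q + 1 + 1] = [1..<q + 1]"
    by (auto simp: filter_id_conv)
  then have "fps_hypergeo (map a [1..<p + 1]) (map b [1..<q + 1]) 1 $ (s + n * k) =
      (\<Prod>i=1..p. pochhammer (a i) (s + n * k)) / (\<Prod>i=1..q + 1. pochhammer (b i) (s + n * k))"
    using fps_hypergeo_nth_omit_one[of "q + 1" "q + 1" b a p 1 "s + n * k"] b_last
    by (simp only: power_one mult_1_right) simp
  also have "\<dots> =
      ((\<Prod>i=1..p. pochhammer (a i) s) * (of_nat n ^ (n * k)) ^ p *
        (\<Prod>m=1..n * p. pochhammer (c m) k)) /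
      ((\<Prod>i=1..q + 1. pochhammer (b i) s) * (of_nat n ^ (n * k)) ^ (q + 1) *
        (\<Prod>m=1..n * (q + 1). pochhammer (d m) k))"
    by (simp only: prod_pochhammer_progression[of n p c a s k, OF n c]
        prod_pochhammer_progression[of n "q + 1" d b s k, OF n d])
  also have "\<dots> =
      (\<Prod>i=1..p. pochhammer (a i) s) / (\<Prod>i=1..q + 1. pochhammer (b i) s) *
      ((\<Prod>m=1..n * p. pochhammer (c m) k) *
        ((of_nat n ^ (n * k)) ^ p / (of_nat n ^ (n * k)) ^ (q + 1)) /
        (\<Prod>m=1..n * (q + 1). pochhammer (d m) k))"
    by (simp add: mult_ac)
  also have "(of_nat n ^ (n * k)) ^ p / (of_nat n ^ (n * k)) ^ (q + 1) = ?w ^ k"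
  proof -
    have "?w = of_nat n powi (int (n * p) - int (n * (q + 1)))"
      by (simp add: algebra_simps)
    also have "\<dots> = of_nat n ^ (n * p) / of_nat n ^ (n * (q + 1))"
      using n by (subst power_int_diff) (auto simp only: power_int_of_nat of_nat_eq_0_iff)
    finally show ?thesis
      by (simp only: power_divide power_mult[symmetric] mult_ac)
  qed
  finally show "fps_hypergeo (map a [1..<p + 1]) (map b [1..<q + 1]) 1 $ (s + n * k) =
      (\<Prod>i=1..p. pochhammer (a i) s) / (\<Prod>i=1..q + 1. pochhammer (b i) s) *
      fps_hypergeo (map c [1..<n * p + 1])
        (map d (filter (\<lambda>m. m \<noteq> q * n + (n - s)) [1..<n * (q + 1) + 1])) ?w $ k"
    unfolding fps_hypergeo_nth_omit_one[where d = d, OF i0 d_one] .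
qed

section \<open>The action of the operator on hypergeometric series\<close>

theorem theorem5p1:
  fixes j n p q :: nat and a b :: "nat \<Rightarrow> complex"
  assumes n: "n \<ge> 1"
    and a: "\<And>i. i \<in> {1..p} \<Longrightarrow> a i \<noteq> 0"
    and b: "\<And>i. i \<in> {1..q} \<Longrightarrow> b i \<noteq> 0 \<and> b i \<notin> \<int>\<^sub>\<le>\<^sub>0"
    and b_last: "b (q + 1) = 1"
  shows
    "(n dvd j \<longrightarrow>
       (\<forall>c d :: nat \<Rightarrow> complex.
          (\<forall>i\<in>{0..<p}. \<forall>l\<in>{1..n}.
             c (i * n + l) = (a (i + 1) + of_nat l - 1) / of_nat n) \<longrightarrow>
          (\<forall>i\<in>{0..q}. \<forall>l\<in>{1..n}.
             d (i * n + l) = (b (i + 1) + of_nat l - 1) / of_nat n) \<longrightarrow>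
          U_op n (fps_X ^ j * fps_hypergeo (map a [1..<p + 1]) (map b [1..<q + 1]) 1) =
          fps_X ^ (j div n) *
          fps_hypergeo (map c [1..<n * p + 1]) (map d [1..<n * (q + 1)])
            (of_nat n powi (int n * (int p - int q - 1)))))
     \<and>
     (\<not> n dvd j \<longrightarrow>
       (\<forall>(r :: nat) (c :: nat \<Rightarrow> complex) (d :: nat \<Rightarrow> complex).
          real r = real n * (1 - frac (real j / real n)) - 1 \<longrightarrow>
          (\<forall>i\<in>{0..<p}. \<forall>l\<in>{1..n}.
             c (i * n + l) = (a (i + 1) + of_nat r + of_nat l) / of_nat n) \<longrightarrow>
          (\<forall>i\<in>{0..q}. \<forall>l\<in>{1..n}.
             d (i * n + l) = (b (i + 1) + of_nat r + of_nat l) / of_nat n) \<longrightarrow>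
          U_op n (fps_X ^ j * fps_hypergeo (map a [1..<p + 1]) (map b [1..<q + 1]) 1) =
          fps_const ((\<Prod>i=1..p. pochhammer (a i) (r + 1)) /
                     (\<Prod>i=1..q + 1. pochhammer (b i) (r + 1))) *
          fps_X ^ (1 + nat \<lfloor>real j / real n\<rfloor>) *
          fps_hypergeo (map c [1..<n * p + 1])
            (map d (filter (\<lambda>m. m \<noteq> q * n + (n - 1 - r)) [1..<n * (q + 1) + 1]))
            (of_nat n powi (int n * (int p - int q - 1)))))"
proof (intro conjI impI allI)
  fix c d :: "nat \<Rightarrow> complex"
  assume "n dvd j"
    and c: "\<forall>i\<in>{0..<p}. \<forall>l\<in>{1..n}. c (i * n + l) = (a (i + 1) + of_nat l - 1) / of_nat n"
    and d: "\<forall>i\<in>{0..q}. \<forall>l\<in>{1..n}. d (i * n + l) = (b (i + 1) + of_nat l - 1) / of_nat n"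
  have "filter (\<lambda>m. m \<noteq> q * n + (n - 0)) [1..<n * (q + 1) + 1] = [1..<n * (q + 1)]"
    using n by (auto simp: filter_id_conv algebra_simps)
  then show "U_op n (fps_X ^ j * fps_hypergeo (map a [1..<p + 1]) (map b [1..<q + 1]) 1) =
      fps_X ^ (j div n) *
      fps_hypergeo (map c [1..<n * p + 1]) (map d [1..<n * (q + 1)])
        (of_nat n powi (int n * (int p - int q - 1)))"
    using U_op_fps_hypergeo[of 0 n j "j div n" b q p c a d] n b_last c d \<open>n dvd j\<close>
    by (simp del: upt_Suc)
next
  fix r :: nat and c d :: "nat \<Rightarrow> complex"
  assume "\<not> n dvd j"
    and r: "real r = real n * (1 - frac (real j / real n)) - 1"
    and c: "\<forall>i\<in>{0..<p}. \<forall>l\<in>{1..n}.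
      c (i * n + l) = (a (i + 1) + of_nat r + of_nat l) / of_nat n"
    and d: "\<forall>i\<in>{0..q}. \<forall>l\<in>{1..n}.
      d (i * n + l) = (b (i + 1) + of_nat r + of_nat l) / of_nat n"
  have floor: "\<lfloor>real j / real n\<rfloor> = int (j div n)"
    by (rule floor_divide_of_nat_eq)
  have "real n * (real j / real n) = real j" using n by simp
  then have "real (j + (r + 1)) = real (n * (1 + j div n))"
    using r by (simp add: frac_def floor right_diff_distrib distrib_left)
  then have je: "j + (r + 1) = n * (1 + j div n)"
    by (simp only: of_nat_eq_iff)
  have "j mod n > 0" using \<open>\<not> n dvd j\<close> by (simp add: dvd_eq_mod_eq_0)
  moreover have "j = n * (j div n) + j mod n" by simp
  ultimately have rn: "r + 1 < n" using je unfolding distrib_left by linarith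
  have omitted: "n - (r + 1) = n - 1 - r" by simp
  show "U_op n (fps_X ^ j * fps_hypergeo (map a [1..<p + 1]) (map b [1..<q + 1]) 1) =
      fps_const ((\<Prod>i=1..p. pochhammer (a i) (r + 1)) /
                 (\<Prod>i=1..q + 1. pochhammer (b i) (r + 1))) *
      fps_X ^ (1 + nat \<lfloor>real j / real n\<rfloor>) *
      fps_hypergeo (map c [1..<n * p + 1])
        (map d (filter (\<lambda>m. m \<noteq> q * n + (n - 1 - r)) [1..<n * (q + 1) + 1]))
        (of_nat n powi (int n * (int p - int q - 1)))"
    unfolding floor nat_int
    by (rule U_op_fps_hypergeo[of "r + 1" n j "1 + j div n" b q p c a d,
          OF rn je b_last, unfolded omitted])
      (use c d in auto)
qed

end
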